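(* For any $f,g\in L^2[0,1]$, $$\langle f_P,g_A\rangle=\langle f_A,g_P\rangle=0 .$$
   Context: $L^2[0,1]$ is the Hilbert space of square integrable complex-valued functions on $[0,1]$ with inner product $\langle f,g\rangle=\int_0^1 f(x)\overline{g(x)}\,dx$. For $f\in L^2[0,1]$, $f_P(x)=\frac{f(x)+f(1-x)}{2}$ and $f_A(x)=\frac{f(x)-f(1-x)}{2}$. *)

theory Defs
  imports "HOL-Analysis.Analysis"
begin

text \<open>
  The library has no \<open>L\<^sup>2\<close> spaces. An element of \<open>L\<^sup>2[0,1]\<close> is given here by a representative
  \<open>f :: real \<Rightarrow> complex\<close>, whose values outside \<open>[0,1]\<close> play no role. The lemmas below show that the
  constructions do not depend on the choice of representative, that they stay inside \<open>L\<^sup>2[0,1]\<close>, and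
  that the inner product is the integral of an integrable function (so that the default value \<open>0\<close>
  of the Bochner integral is never used).
\<close>

abbreviation unit_leb :: "real measure" where
  "unit_leb \<equiv> lebesgue_on {0..1}"

definition L2 :: "(real \<Rightarrow> complex) set" where
  "L2 = {f \<in> borel_measurable unit_leb. integrable unit_leb (\<lambda>x. (norm (f x))\<^sup>2)}"

definition L2_inner :: "(real \<Rightarrow> complex) \<Rightarrow> (real \<Rightarrow> complex) \<Rightarrow> complex" where
  "L2_inner f g = (LINT x|unit_leb. f x * cnj (g x))"

definition P_part :: "(real \<Rightarrow> complex) \<Rightarrow> real \<Rightarrow> complex" where
  "P_part f x = (f x + f (1 - x)) / 2"

definition A_part :: "(real \<Rightarrow> complex) \<Rightarrow> real \<Rightarrow> complex" where
  "A_part f x = (f x - f (1 - x)) / 2"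

lemma L2_inner_integrable:
  assumes "f \<in> L2" "g \<in> L2"
  shows "integrable unit_leb (\<lambda>x. f x * cnj (g x))"
proof (rule Bochner_Integration.integrable_bound)
  show "integrable unit_leb (\<lambda>x. (norm (f x))\<^sup>2 + (norm (g x))\<^sup>2)"
    using assms by (auto simp: L2_def)
  have [measurable]: "f \<in> borel_measurable unit_leb" "g \<in> borel_measurable unit_leb"
    using assms by (auto simp: L2_def)
  have "(\<lambda>x. cnj (g x)) \<in> borel_measurable unit_leb"
    by (rule borel_measurable_continuous_on[where f = cnj]) (auto intro: continuous_intros)
  then show "(\<lambda>x. f x * cnj (g x)) \<in> borel_measurable unit_leb"
    by measurable
  have "a * b \<le> a\<^sup>2 + b\<^sup>2" if "0 \<le> a" "0 \<le> b" for a b :: real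
    using that sum_squares_bound[of a b] mult_nonneg_nonneg[OF that] by linarith
  then show "AE x in unit_leb. norm (f x * cnj (g x)) \<le> norm ((norm (f x))\<^sup>2 + (norm (g x))\<^sup>2)"
    by (auto simp: norm_mult)
qed

lemma reflect_measurable: "(\<lambda>x. 1 - x) \<in> unit_leb \<rightarrow>\<^sub>M unit_leb"
proof -
  have "(\<lambda>x::real. 1 + (\<Sum>j\<in>Basis. (-1 * (x \<bullet> j)) *\<^sub>R j)) \<in> lebesgue \<rightarrow>\<^sub>M lebesgue"
    by (rule lebesgue_affine_measurable) auto
  then have "(\<lambda>x::real. 1 - x) \<in> lebesgue \<rightarrow>\<^sub>M lebesgue"
    by simp
  then show ?thesis
    by (intro measurable_restrict_space3) auto
qed

lemma reflect_distr: "distr unit_leb unit_leb (\<lambda>x. 1 - x) = unit_leb"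
proof (rule measure_eqI)
  fix A assume "A \<in> sets (distr unit_leb unit_leb (\<lambda>x. 1 - x))"
  then have A: "A \<in> sets lebesgue" "A \<subseteq> {0..1}"
    by (auto simp: sets_restrict_space_iff)
  have eq: "(\<lambda>x. 1 - x) -` A \<inter> space unit_leb = (\<lambda>x. (-1) *\<^sub>R x + 1) ` A"
    using A by (force simp: image_iff)
  have "emeasure (distr unit_leb unit_leb (\<lambda>x. 1 - x)) A =
      emeasure unit_leb ((\<lambda>x. 1 - x) -` A \<inter> space unit_leb)"
    using A by (intro emeasure_distr reflect_measurable) (auto simp: sets_restrict_space_iff)
  also have "\<dots> = emeasure lebesgue ((\<lambda>x. (-1) *\<^sub>R x + 1) ` A)"
    unfolding eq using A by (intro emeasure_restrict_space) auto
  also have "\<dots> = emeasure lebesgue A"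
    using emeasure_lebesgue_affine[of "-1" 1 A] by simp
  also have "\<dots> = emeasure unit_leb A"
    using A by (intro emeasure_restrict_space[symmetric]) auto
  finally show "emeasure (distr unit_leb unit_leb (\<lambda>x. 1 - x)) A = emeasure unit_leb A" .
qed simp

lemma reflect_L2:
  assumes "f \<in> L2"
  shows "(\<lambda>x. f (1 - x)) \<in> L2"
proof -
  have f: "f \<in> borel_measurable unit_leb" and i: "integrable unit_leb (\<lambda>x. (norm (f x))\<^sup>2)"
    using assms by (auto simp: L2_def)
  have "integrable (distr unit_leb unit_leb (\<lambda>x. 1 - x)) (\<lambda>x. (norm (f x))\<^sup>2)"
    by (simp only: reflect_distr i)
  then have "integrable unit_leb (\<lambda>x. (norm (f (1 - x)))\<^sup>2)"
    by (rule integrable_distr[OF reflect_measurable])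
  then show ?thesis
    using measurable_compose[OF reflect_measurable f] by (auto simp: L2_def)
qed

lemma L2_half_combination:
  assumes "f \<in> L2" "g \<in> L2"
  shows "(\<lambda>x. (f x + g x) / 2) \<in> L2" "(\<lambda>x. (f x - g x) / 2) \<in> L2"
proof -
  have [measurable]: "f \<in> borel_measurable unit_leb" "g \<in> borel_measurable unit_leb"
    using assms by (auto simp: L2_def)
  have i: "integrable unit_leb (\<lambda>x. (norm (f x))\<^sup>2 + (norm (g x))\<^sup>2)"
    using assms by (auto simp: L2_def)
  have bound: "(norm c / 2)\<^sup>2 \<le> (norm a)\<^sup>2 + (norm b)\<^sup>2"
    if "norm c \<le> norm a + norm b" for a b c :: complex
  proof -
    have "(norm c)\<^sup>2 \<le> (norm a + norm b)\<^sup>2"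
      using that by (intro power_mono) auto
    also have "\<dots> \<le> 2 * ((norm a)\<^sup>2 + (norm b)\<^sup>2)"
      using sum_squares_bound[of "norm a" "norm b"] by (simp add: power2_sum)
    finally have "(norm c)\<^sup>2 \<le> 2 * ((norm a)\<^sup>2 + (norm b)\<^sup>2)" .
    moreover have "0 \<le> (norm a)\<^sup>2" "0 \<le> (norm b)\<^sup>2"
      by auto
    moreover have "(norm c / 2)\<^sup>2 = (norm c)\<^sup>2 / 4"
      by (simp add: power_divide)
    moreover have "u / 4 \<le> v" if "u \<le> 2 * v" "0 \<le> v" for u v :: real
      using that by linarith
    ultimately show ?thesis
      by (metis add_nonneg_nonneg)
  qed
  have "integrable unit_leb (\<lambda>x. (norm ((f x + g x) / 2))\<^sup>2)"
    by (rule Bochner_Integration.integrable_bound[OF i])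
       (auto simp: norm_divide intro!: AE_I2 bound norm_triangle_ineq)
  moreover have "integrable unit_leb (\<lambda>x. (norm ((f x - g x) / 2))\<^sup>2)"
    by (rule Bochner_Integration.integrable_bound[OF i])
       (auto simp: norm_divide intro!: AE_I2 bound norm_triangle_ineq4)
  ultimately show "(\<lambda>x. (f x + g x) / 2) \<in> L2" "(\<lambda>x. (f x - g x) / 2) \<in> L2"
    by (auto simp: L2_def)
qed

lemma P_part_L2: "f \<in> L2 \<Longrightarrow> P_part f \<in> L2"
  and A_part_L2: "f \<in> L2 \<Longrightarrow> A_part f \<in> L2"
  using L2_half_combination[OF _ reflect_L2, of f f]
  by (simp_all add: P_part_def[abs_def] A_part_def[abs_def])

lemma parts_AE_cong:
  assumes "AE x in unit_leb. f x = g x"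
  shows "AE x in unit_leb. P_part f x = P_part g x" "AE x in unit_leb. A_part f x = A_part g x"
proof -
  have "AE x in distr unit_leb unit_leb (\<lambda>x. 1 - x). f x = g x"
    by (simp only: reflect_distr assms)
  then have "AE x in unit_leb. f (1 - x) = g (1 - x)"
    by (rule AE_distrD[OF reflect_measurable])
  with assms show "AE x in unit_leb. P_part f x = P_part g x" "AE x in unit_leb. A_part f x = A_part g x"
    by (auto simp: P_part_def A_part_def elim: AE_mp)
qed

lemma L2_inner_AE_cong:
  assumes "f \<in> L2" "f' \<in> L2" "g \<in> L2" "g' \<in> L2"
    and "AE x in unit_leb. f x = f' x" "AE x in unit_leb. g x = g' x"
  shows "L2_inner f g = L2_inner f' g'"
  unfolding L2_inner_def
proof (rule integral_cong_AE)
  show "AE x in unit_leb. f x * cnj (g x) = f' x * cnj (g' x)"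
    using assms(5,6) by eventually_elim simp
qed (use L2_inner_integrable assms in \<open>blast intro: borel_measurable_integrable\<close>)+

end

theory Submission
  imports Defs
begin

text \<open>
  The reflection \<open>x \<mapsto> 1 - x\<close> fixes \<open>f\<^sub>P\<close> and changes the sign of \<open>f\<^sub>A\<close>. Hence both integrands
  \<open>f\<^sub>P \<cdot> cnj g\<^sub>A\<close> and \<open>f\<^sub>A \<cdot> cnj g\<^sub>P\<close> are odd about the midpoint \<open>1/2\<close>. As the reflection preserves
  Lebesgue measure on \<open>[0,1]\<close>, the integral of such a function equals its own negative, so it
  vanishes (lemma \<open>integral_reflect_odd\<close>).
\<close>

lemma P_part_reflect: "P_part f (1 - x) = P_part f x"
  by (simp add: P_part_def add.commute)

lemma A_part_reflect: "A_part f (1 - x) = - A_part f x"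
  by (simp add: A_part_def minus_divide_left)

lemma integral_reflect:
  fixes h :: "real \<Rightarrow> 'a::{banach, second_countable_topology}"
  assumes "h \<in> borel_measurable unit_leb"
  shows "(LINT x|unit_leb. h (1 - x)) = (LINT x|unit_leb. h x)"
  using integral_distr[OF reflect_measurable assms] by (simp only: reflect_distr)

text \<open>Substituting \<open>1 - x\<close> for \<open>x\<close> gives \<open>I = -I\<close> for the integral \<open>I\<close>.\<close>

lemma integral_reflect_odd:
  fixes h :: "real \<Rightarrow> 'a::{banach, second_countable_topology}"
  assumes "h \<in> borel_measurable unit_leb" and "\<And>x. h (1 - x) = - h x"
  shows "(LINT x|unit_leb. h x) = 0"
proof -
  have "(LINT x|unit_leb. h x) = - (LINT x|unit_leb. h x)"
    using integral_reflect[OF assms(1)] by (simp add: assms(2))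
  then show ?thesis
    by (metis eq_neg_iff_add_eq_0 scaleR_2 scaleR_eq_0_iff zero_neq_numeral)
qed

lemma L2_inner_eq_0_if_product_odd:
  assumes "f \<in> L2" "g \<in> L2"
    and "\<And>x. f (1 - x) * cnj (g (1 - x)) = - (f x * cnj (g x))"
  shows "L2_inner f g = 0"
  unfolding L2_inner_def
  using borel_measurable_integrable[OF L2_inner_integrable[OF assms(1,2)]] assms(3)
  by (rule integral_reflect_odd)

theorem theorem2p24:
  fixes f g :: "real \<Rightarrow> complex"
  assumes "f \<in> L2" and "g \<in> L2"
  shows "L2_inner (P_part f) (A_part g) = 0 \<and> L2_inner (A_part f) (P_part g) = 0"
  using assms
  by (simp add: L2_inner_eq_0_if_product_odd P_part_L2 A_part_L2 P_part_reflect A_part_reflect)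

end
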